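(* Let $\mathbb{F}$ be an algebraically closed field of characteristic zero and let $n,m,d,k\ge 1$ be integers. Let $V=\mathrm{Ten}(n,d)$ with set of simples $S=\{\mathbf v_1\otimes\cdots\otimes\mathbf v_d:\mathbf v_i\in\mathbb F^n\}$. For every nonzero linear map $\phi:\mathrm{Ten}(n,d)\to\mathrm{Ten}(m,k)$ (a $T_k$-rank method), its potency satisfies $$\mathrm{Pot}(\phi)\le k^d\cdot n^{\lfloor (k-1)d/k\rfloor}.$$
   Context: $\mathrm{Ten}(n,d)=\mathbb F^n\otimes\cdots\otimes\mathbb F^n$ ($d$ factors). A tensor of the form $\mathbf v_1\otimes\cdots\otimes\mathbf v_d$ is called simple (rank 1). The tensor rank $\mathrm{trk}(T)$ is the least $r$ such that $T$ is a sum of $r$ simple tensors. For a linear map $\phi:V\to\mathrm{Ten}(m,k)$ and a spanning set $S\subseteq V$ of "simples", set $\mu_\phi(v)=\mathrm{trk}(\phi(v))$, $\mu_\phi(X)=\max\{\mu_\phi(x):x\in X\}$ for $X\subseteq V$, and define the potency $\mathrm{Pot}(\phi)=\mu_\phi(V)/\mu_\phi(S)$. *)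

theory Defs
  imports "HOL-Computational_Algebra.Polynomial"
begin

definition alg_closed :: "'a::field itself \<Rightarrow> bool" where
  "alg_closed _ \<longleftrightarrow> (\<forall>p :: 'a poly. degree p \<ge> 1 \<longrightarrow> (\<exists>x. poly p x = 0))"

definition vecs :: "nat \<Rightarrow> (nat \<Rightarrow> 'a::zero) set" where
  "vecs n = {v. \<forall>i\<ge>n. v i = 0}"

definition idx :: "nat \<Rightarrow> nat \<Rightarrow> nat list set" where
  "idx n d = {xs. length xs = d \<and> (\<forall>i\<in>set xs. i < n)}"

text \<open>Ten(n,d) = F^n (x) ... (x) F^n (d factors): functions on multi-indices
  supported on idx n d.\<close>
definition Ten :: "nat \<Rightarrow> nat \<Rightarrow> (nat list \<Rightarrow> 'a::zero) set" where
  "Ten n d = {T. \<forall>xs. xs \<notin> idx n d \<longrightarrow> T xs = 0}"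

definition tprod :: "nat \<Rightarrow> nat \<Rightarrow> (nat \<Rightarrow> 'a::comm_semiring_1) list \<Rightarrow> nat list \<Rightarrow> 'a" where
  "tprod n d vs = (\<lambda>xs. if xs \<in> idx n d then (\<Prod>j<d. (vs ! j) (xs ! j)) else 0)"

definition simples :: "nat \<Rightarrow> nat \<Rightarrow> (nat list \<Rightarrow> 'a::comm_semiring_1) set" where
  "simples n d = {tprod n d vs | vs. length vs = d \<and> (\<forall>v\<in>set vs. v \<in> vecs n)}"

definition trk :: "nat \<Rightarrow> nat \<Rightarrow> (nat list \<Rightarrow> 'a::comm_semiring_1) \<Rightarrow> nat" where
  "trk n d T = (LEAST r. \<exists>ts. length ts = r \<and> set ts \<subseteq> simples n d \<and> T = (\<lambda>xs. \<Sum>t\<leftarrow>ts. t xs))"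

definition lin_map :: "nat \<Rightarrow> nat \<Rightarrow> nat \<Rightarrow> nat \<Rightarrow>
    ((nat list \<Rightarrow> 'a::field) \<Rightarrow> (nat list \<Rightarrow> 'a)) \<Rightarrow> bool" where
  "lin_map n d m k \<phi> \<longleftrightarrow>
     (\<forall>T\<in>Ten n d. \<phi> T \<in> Ten m k) \<and>
     (\<forall>T\<in>Ten n d. \<forall>U\<in>Ten n d. \<phi> (\<lambda>xs. T xs + U xs) = (\<lambda>xs. \<phi> T xs + \<phi> U xs)) \<and>
     (\<forall>c. \<forall>T\<in>Ten n d. \<phi> (\<lambda>xs. c * T xs) = (\<lambda>xs. c * \<phi> T xs))"

text \<open>mu_phi(X) = max of trk(phi x) over x in X (a bounded set of naturals).\<close>
definition mu :: "nat \<Rightarrow> nat \<Rightarrow> ((nat list \<Rightarrow> 'a::field) \<Rightarrow> (nat list \<Rightarrow> 'a)) \<Rightarrow>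
    (nat list \<Rightarrow> 'a) set \<Rightarrow> nat" where
  "mu m k \<phi> X = Max ((\<lambda>x. trk m k (\<phi> x)) ` X)"

definition Pot :: "nat \<Rightarrow> nat \<Rightarrow> nat \<Rightarrow> nat \<Rightarrow>
    ((nat list \<Rightarrow> 'a::field) \<Rightarrow> (nat list \<Rightarrow> 'a)) \<Rightarrow> real" where
  "Pot n d m k \<phi> = real (mu m k \<phi> (Ten n d)) / real (mu m k \<phi> (simples n d))"

end

theory Submission
  imports Defs "HOL-Library.FuncSet"
begin

text \<open>
  Let \<open>r\<close> bound the rank of \<open>\<phi>\<close> on simple tensors. A decomposition of
  \<open>\<phi> (x\<^sub>1 \<otimes> \<dots> \<otimes> x\<^sub>d)\<close> into \<open>r\<close> simple tensors, chosen separately at every point \<open>x\<close>, is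
  a single decomposition over an ultrapower \<open>K\<close> of the ground field; if the ultrafilter contains all
  nonempty Zariski-open sets, the coordinates become algebraically independent elements of \<open>K\<close>. In
  characteristic zero the partial derivatives extend to derivations of \<open>K\<close>. Differentiating once in
  a coordinate of each \<open>x\<^sub>1, \<dots>, x\<^sub>d\<close> turns the left-hand side into \<open>\<phi> (e\<^sub>I)\<close>, while the Leibniz rule
  distributes the \<open>d\<close> derivatives over the \<open>k\<close> factors of each simple tensor in \<open>k ^ d\<close> ways. In each
  way some factor receives at least \<open>d / k\<close> of the derivatives; summing over those indices inside
  that factor leaves at most \<open>n ^ ((k - 1) * d div k)\<close> simple tensors over \<open>K\<close>, uniformly in the
  tensor to be decomposed. Evaluating at a generic point brings the decomposition back to the ground
  field.
\<close>

section \<open>Extension of derivations in characteristic zero\<close>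

text \<open>The graph of a derivation from a subring of \<open>'k\<close> into \<open>'k\<close>; equivalently, a subring of the dual
  numbers over \<open>'k\<close> that meets the multiples of \<open>\<epsilon>\<close> trivially.\<close>

definition der_graph :: "('k::field_char_0 \<times> 'k) set \<Rightarrow> bool" where
  "der_graph G \<longleftrightarrow> (0, 0) \<in> G \<and> (1, 0) \<in> G \<and> (-1, 0) \<in> G \<and>
     (\<forall>a a' b b'. (a, a') \<in> G \<longrightarrow> (b, b') \<in> G \<longrightarrow>
        (a + b, a' + b') \<in> G \<and> (a * b, a * b' + a' * b) \<in> G) \<and>
     (\<forall>b. (0, b) \<in> G \<longrightarrow> b = 0)"

lemma der_graphD:
  assumes "der_graph G"
  shows "(0, 0) \<in> G" "(1, 0) \<in> G" "(-1, 0) \<in> G"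
    "(a, a') \<in> G \<Longrightarrow> (b, b') \<in> G \<Longrightarrow> (a + b, a' + b') \<in> G"
    "(a, a') \<in> G \<Longrightarrow> (b, b') \<in> G \<Longrightarrow> (a * b, a * b' + a' * b) \<in> G"
    "(0, b) \<in> G \<Longrightarrow> b = 0"
  using assms unfolding der_graph_def by blast+

lemma der_graph_uminus:
  assumes "der_graph G" "(a, a') \<in> G"
  shows "(- a, - a') \<in> G"
  using der_graphD(5)[OF assms(1) der_graphD(3)[OF assms(1)] assms(2)] by simp

lemma der_graph_diff:
  assumes "der_graph G" "(a, a') \<in> G" "(b, b') \<in> G"
  shows "(a - b, a' - b') \<in> G"
  using der_graphD(4)[OF assms(1,2) der_graph_uminus[OF assms(1,3)]] by simp

lemma der_graph_of_nat:
  assumes "der_graph G" "(a, a') \<in> G"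
  shows "(of_nat k * a, of_nat k * a') \<in> G"
proof (induction k)
  case 0
  then show ?case using der_graphD(1)[OF assms(1)] by simp
next
  case (Suc k)
  then show ?case using der_graphD(4)[OF assms(1,2) Suc] by (simp add: algebra_simps)
qed

lemma der_graph_sum:
  assumes "der_graph G" "\<And>i. i \<in> A \<Longrightarrow> (f i, f' i) \<in> G"
  shows "((\<Sum>i\<in>A. f i), (\<Sum>i\<in>A. f' i)) \<in> G"
  using assms(2)
  by (induction A rule: infinite_finite_induct)
     (auto simp: der_graphD(1)[OF assms(1)] intro: der_graphD(4)[OF assms(1)])

lemma der_graph_single_valued:
  assumes "der_graph G" "(a, b) \<in> G" "(a, c) \<in> G"
  shows "b = c"
  using der_graphD(6)[OF assms(1)] der_graph_diff[OF assms] by fastforce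

section \<open>Polynomials over the domain of a derivation, differentiated coefficientwise\<close>

definition poly_graph :: "('k::field_char_0 \<times> 'k) set \<Rightarrow> ('k poly \<times> 'k poly) set" where
  "poly_graph G = {(p, p'). \<forall>i. (coeff p i, coeff p' i) \<in> G}"

lemma poly_graph_mult:
  assumes "der_graph G" "(p, p') \<in> poly_graph G" "(q, q') \<in> poly_graph G"
  shows "(p * q, p * q' + p' * q) \<in> poly_graph G"
proof -
  have "coeff (p * q' + p' * q) i = (\<Sum>j\<le>i. coeff p j * coeff q' (i - j) + coeff p' j * coeff q (i - j))" for i
    by (simp add: coeff_mult sum.distrib)
  then show ?thesis
    using assms unfolding poly_graph_def
    by (auto simp: coeff_mult simp del: coeff_add intro!: der_graph_sum der_graphD(5))
qed

lemma poly_graph_add: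
  assumes "der_graph G" "(p, p') \<in> poly_graph G" "(q, q') \<in> poly_graph G"
  shows "(p + q, p' + q') \<in> poly_graph G"
  using assms unfolding poly_graph_def by (auto intro: der_graphD(4))

lemma poly_graph_diff:
  assumes "der_graph G" "(p, p') \<in> poly_graph G" "(q, q') \<in> poly_graph G"
  shows "(p - q, p' - q') \<in> poly_graph G"
  using assms unfolding poly_graph_def by (auto intro: der_graph_diff)

lemma poly_graph_monom:
  assumes "der_graph G" "(a, a') \<in> G"
  shows "(monom a e, monom a' e) \<in> poly_graph G"
  using assms unfolding poly_graph_def by (auto simp: coeff_monom der_graphD(1))

lemma poly_graph_const:
  assumes "der_graph G" "(a, a') \<in> G"
  shows "([:a:], [:a':]) \<in> poly_graph G"
  using poly_graph_monom[OF assms, of 0] by (simp add: monom_0)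

lemma poly_graph_pderiv:
  assumes "der_graph G" "(p, p') \<in> poly_graph G"
  shows "(pderiv p, pderiv p') \<in> poly_graph G"
  using assms unfolding poly_graph_def by (auto simp: coeff_pderiv simp del: of_nat_Suc intro: der_graph_of_nat)

lemma poly_graph_zero:
  assumes "der_graph G" "(0, p') \<in> poly_graph G"
  shows "p' = 0"
  using assms unfolding poly_graph_def by (auto intro!: poly_eqI der_graphD(6))

text \<open>The value at \<open>p(y)\<close> forced on any derivation that extends the given one and
  sends \<open>y\<close> to \<open>z\<close>. Here \<open>p'\<close> is the coefficientwise
  derivative of \<open>p\<close>, while \<open>pderiv p\<close> is the formal one.\<close>

definition poly_der :: "'k::field_char_0 \<Rightarrow> 'k \<Rightarrow> 'k poly \<Rightarrow> 'k poly \<Rightarrow> 'k" where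
  "poly_der y z p p' = poly p' y + poly (pderiv p) y * z"

lemma poly_der_add: "poly_der y z (p + q) (p' + q') = poly_der y z p p' + poly_der y z q q'"
  by (simp add: poly_der_def pderiv_add algebra_simps)

lemma poly_der_diff: "poly_der y z (p - q) (p' - q') = poly_der y z p p' - poly_der y z q q'"
  by (simp add: poly_der_def pderiv_diff algebra_simps)

lemma poly_der_mult:
  "poly_der y z (p * q) (p * q' + p' * q) = poly p y * poly_der y z q q' + poly_der y z p p' * poly q y"
  by (simp add: poly_der_def pderiv_mult algebra_simps)

lemma poly_der_const: "poly_der y z [:a:] [:a':] = a'"
  by (simp add: poly_der_def pderiv_pCons)

text \<open>If \<open>y\<close> is algebraic over the domain, its derivative \<open>z\<close> is forced by a relation \<open>q\<close> of minimal
  degree, which is separable at \<open>y\<close>; every other relation reduces to \<open>q\<close> by pseudo-division.\<close>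

lemma ex_compatible_derivative:
  fixes y :: "'k::field_char_0"
  assumes G: "der_graph G"
  shows "\<exists>z. \<forall>(p, p') \<in> poly_graph G. poly p y = 0 \<longrightarrow> poly_der y z p p' = 0"
proof (cases "\<exists>p p'. (p, p') \<in> poly_graph G \<and> poly p y = 0 \<and> p \<noteq> 0")
  case False
  \<comment> \<open>\<open>y\<close> is transcendental over the domain, so only the zero polynomial
    vanishes at \<open>y\<close> and every choice of \<open>z\<close> is compatible; 0 is
    taken.\<close>
  then have "poly_der y 0 p p' = 0" if "(p, p') \<in> poly_graph G" "poly p y = 0" for p p'
    using that poly_graph_zero[OF G, of p'] by (cases "p = 0") (auto simp: poly_der_def)
  then show ?thesis by blast
next
  case True
  define Q where "Q = (\<lambda>m. \<exists>p p'. (p, p') \<in> poly_graph G \<and> poly p y = 0 \<and> p \<noteq> 0 \<and> degree p = m)"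
  have "Q (LEAST m. Q m)"
    by (rule LeastI_ex) (use True in \<open>auto simp: Q_def\<close>)
  then obtain q q' where q: "(q, q') \<in> poly_graph G" "poly q y = 0" "q \<noteq> 0" "degree q = (LEAST m. Q m)"
    unfolding Q_def by blast
  have min: "degree q \<le> degree p" if "(p, p') \<in> poly_graph G" "poly p y = 0" "p \<noteq> 0" for p p'
    unfolding q(4) by (rule Least_le) (use that in \<open>auto simp: Q_def\<close>)
  have dq: "degree q > 0"
    using q(2,3) by (auto elim!: degree_eq_zeroE intro!: gr0I)
  have nz: "poly (pderiv q) y \<noteq> 0"
  proof
    assume "poly (pderiv q) y = 0"
    \<comment> \<open>Separability: in characteristic zero \<open>pderiv q\<close> is a nonzero
      relation of smaller degree, against the minimality of \<open>q\<close>.\<close>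
    moreover have "pderiv q \<noteq> 0" using dq by (simp add: pderiv_eq_0_iff)
    ultimately have "degree q \<le> degree (pderiv q)"
      using min poly_graph_pderiv[OF G q(1)] by blast
    then show False using dq by (simp add: degree_pderiv)
  qed
  \<comment> \<open>The unique solution of the linear equation
    \<open>poly_der y z q q' = 0\<close>.\<close>
  define z where "z = - poly q' y / poly (pderiv q) y"
  have Eq: "poly_der y z q q' = 0"
    using nz by (simp add: poly_der_def z_def)
  have "poly_der y z h h' = 0" if "(h, h') \<in> poly_graph G" "poly h y = 0" for h h'
    using that
  proof (induction "degree h" arbitrary: h h' rule: less_induct)
    case less
    show ?case
    proof (cases "h = 0")
      case True
      then show ?thesis using less.prems poly_graph_zero[OF G, of h'] by (simp add: poly_der_def)
    next
      case False
      then have le: "degree q \<le> degree h" using min less.prems by blast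
      define a a' b b' e where "a = lead_coeff q" and "a' = coeff q' (degree q)"
        and "b = lead_coeff h" and "b' = coeff h' (degree h)" and "e = degree h - degree q"
      have aG: "(a, a') \<in> G" and bG: "(b, b') \<in> G"
        using q(1) less.prems(1) by (auto simp: a_def a'_def b_def b'_def poly_graph_def)
      \<comment> \<open>One step of pseudo-division. The domain of \<open>G\<close> is only a ring,
        so \<open>h\<close> is multiplied by the leading coefficient of \<open>q\<close> instead of
        dividing by it; \<open>g'\<close> is the coefficientwise derivative of \<open>g\<close>
        given by the product rule.\<close>
      define g where "g = [:a:] * h - monom b e * q"
      define g' where "g' = ([:a:] * h' + [:a':] * h) - (monom b e * q' + monom b' e * q)"
      have gG: "(g, g') \<in> poly_graph G"
        unfolding g_def g'_def
        by (intro poly_graph_diff poly_graph_mult poly_graph_const poly_graph_monom G aG bG less.prems q)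
      have "degree (monom b e * q) \<le> degree h"
        using degree_mult_le[of "monom b e" q] degree_monom_le[of b e] le by (simp add: e_def)
      moreover have "degree ([:a:] * h) \<le> degree h" by simp
      ultimately have "degree g \<le> degree h"
        unfolding g_def by (rule degree_diff_le[rotated])
      moreover have "coeff g (degree h) = 0"
        using le by (simp add: g_def coeff_monom_mult e_def a_def b_def)
      ultimately have "degree g < degree h"
        using dq le eq_zero_or_degree_less[of g "degree h"] by auto
      moreover have "poly g y = 0"
        using less.prems q by (simp add: g_def)
      ultimately have "poly_der y z g g' = 0"
        using less.hyps gG by blast
      \<comment> \<open>All other terms of the product rule contain \<open>poly h y\<close>,
        \<open>poly q y\<close> or \<open>poly_der y z q q'\<close>, which are 0.\<close>
      moreover have "poly_der y z g g' = a * poly_der y z h h'"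
        unfolding g_def g'_def poly_der_diff poly_der_mult poly_der_const
        using less.prems q Eq by simp
      moreover have "a \<noteq> 0" using q(3) by (simp add: a_def)
      ultimately show ?thesis by simp
    qed
  qed
  then show ?thesis by auto
qed

text \<open>The domain is enlarged to all values \<open>p(y)\<close>. An element may have several
  such representations, and the compatibility of \<open>z\<close> is exactly what makes the extended
  derivative independent of the choice.\<close>

lemma der_graph_extend:
  fixes y :: "'k::field_char_0"
  assumes G: "der_graph G"
  shows "\<exists>G' z. der_graph G' \<and> G \<subseteq> G' \<and> (y, z) \<in> G'"
proof -
  obtain z where z: "\<And>p p'. (p, p') \<in> poly_graph G \<Longrightarrow> poly p y = 0 \<Longrightarrow> poly_der y z p p' = 0"
    using ex_compatible_derivative[OF G, of y] by blast
  define G' where "G' = {(poly p y, poly_der y z p p') | p p'. (p, p') \<in> poly_graph G}"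
  have I: "(u, v) \<in> G'" if "(p, p') \<in> poly_graph G" "u = poly p y" "v = poly_der y z p p'" for p p' u v
    using that unfolding G'_def by blast
  have sub: "G \<subseteq> G'"
    using poly_graph_const[OF G] by (force intro: I simp: poly_der_const)
  have "(a + b, a' + b') \<in> G'" "(a * b, a * b' + a' * b) \<in> G'"
    if ab: "(a, a') \<in> G'" "(b, b') \<in> G'" for a a' b b'
  proof -
    obtain p p' q q' where pq: "(p, p') \<in> poly_graph G" "(q, q') \<in> poly_graph G"
      "a = poly p y" "a' = poly_der y z p p'" "b = poly q y" "b' = poly_der y z q q'"
      using ab unfolding G'_def by auto
    show "(a + b, a' + b') \<in> G'"
      by (rule I[OF poly_graph_add[OF G pq(1,2)]]) (simp_all add: pq poly_der_add)
    show "(a * b, a * b' + a' * b) \<in> G'"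
      by (rule I[OF poly_graph_mult[OF G pq(1,2)]]) (simp_all add: pq poly_der_mult)
  qed
  moreover have "b = 0" if "(0, b) \<in> G'" for b
    using that z unfolding G'_def by auto
  ultimately have "der_graph G'"
    using sub G unfolding der_graph_def by blast
  moreover have "(y, z) \<in> G'"
    \<comment> \<open>\<open>y\<close> is the value of the polynomial \<open>monom 1 1\<close>,
      whose coefficients have derivative 0 and whose formal derivative is 1.\<close>
    by (rule I[OF poly_graph_monom[OF G der_graphD(2)[OF G], of 1]])
       (simp_all add: poly_monom poly_der_def pderiv_monom)
  ultimately show ?thesis using sub by blast
qed

lemma der_graph_Union:
  assumes "\<C> \<noteq> {}" "subset.chain {G. der_graph G} \<C>"
  shows "der_graph (\<Union>\<C>)"
proof -
  have dg: "\<And>G. G \<in> \<C> \<Longrightarrow> der_graph G"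
    and tot: "\<And>G H. G \<in> \<C> \<Longrightarrow> H \<in> \<C> \<Longrightarrow> G \<subseteq> H \<or> H \<subseteq> G"
    using assms(2) by (auto simp: subset_chain_def)
  obtain G0 where G0: "G0 \<in> \<C>" using assms(1) by blast
  have "(a + b, a' + b') \<in> \<Union>\<C> \<and> (a * b, a * b' + a' * b) \<in> \<Union>\<C>"
    if ab: "(a, a') \<in> \<Union>\<C>" "(b, b') \<in> \<Union>\<C>" for a a' b b'
  proof -
    obtain G where "G \<in> \<C>" "(a, a') \<in> G" "(b, b') \<in> G"
      using ab tot by (meson UnionE subsetD)
    then show ?thesis using der_graphD(4,5)[OF dg] by blast
  qed
  then show ?thesis
    using der_graphD(1-3)[OF dg[OF G0]] G0 der_graphD(6)[OF dg]
    unfolding der_graph_def by (intro conjI) (blast+)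
qed

text \<open>By Zorn there is a maximal graph above \<open>G\<close>. It is total, since
  \<open>der_graph_extend\<close> would otherwise add a missing point.\<close>

lemma der_graph_total_extension:
  fixes G :: "('k::field_char_0 \<times> 'k) set"
  assumes G: "der_graph G"
  shows "\<exists>D. (\<forall>a b. D (a + b) = D a + D b) \<and> (\<forall>a b. D (a * b) = a * D b + D a * b) \<and>
    (\<forall>(a, b)\<in>G. D a = b)"
proof -
  define A where "A = {H. der_graph H \<and> G \<subseteq> H}"
  have "\<exists>M\<in>A. \<forall>X\<in>A. M \<subseteq> X \<longrightarrow> X = M"
  proof (rule subset_Zorn_nonempty)
    show "A \<noteq> {}" using G by (auto simp: A_def)
    fix \<C> assume C: "\<C> \<noteq> {}" "subset.chain A \<C>"
    have "subset.chain {H. der_graph H} \<C>"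
      using C(2) by (simp add: subset_chain_def A_def subset_iff)
    moreover have "G \<subseteq> \<Union>\<C>"
      using C by (simp add: subset_chain_def A_def subset_iff) (metis ex_in_conv)
    ultimately
    show "\<Union>\<C> \<in> A" using der_graph_Union[OF C(1)] by (simp add: A_def)
  qed
  then obtain M where MA: "M \<in> A" and max: "\<And>X. X \<in> A \<Longrightarrow> M \<subseteq> X \<Longrightarrow> X = M"
    by (metis (no_types, lifting))
  then have M: "der_graph M" "G \<subseteq> M" by (simp_all add: A_def)
  have "\<exists>z. (y, z) \<in> M" for y
  proof -
    obtain M' z where "der_graph M'" "M \<subseteq> M'" "(y, z) \<in> M'"
      using der_graph_extend[OF M(1)] by blast
    then show ?thesis using max[of M'] M(2) by (auto simp: A_def)
  qed
  then obtain D where D: "\<And>y. (y, D y) \<in> M" by metis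
  have eq: "D a = b" if "(a, b) \<in> M" for a b
    using der_graph_single_valued[OF M(1) D that] .
  show ?thesis
    using M(2) by (intro exI[of _ D]) (auto intro!: eq der_graphD(4,5)[OF M(1)] D)
qed

section \<open>An ultrapower with generic coordinates\<close>

text \<open>A maximal family \<open>M\<close> with the finite intersection property is obtained by
  Zorn and generates the required filter.\<close>

lemma finite_intersection_ultrafilter:
  fixes B :: "'b set set"
  assumes B: "\<And>X. X \<subseteq> B \<Longrightarrow> finite X \<Longrightarrow> \<Inter>X \<noteq> {}"
  shows "\<exists>U. U \<noteq> bot \<and> (\<forall>S\<in>B. eventually (\<lambda>x. x \<in> S) U) \<and>
    (\<forall>P. eventually P U \<or> eventually (\<lambda>x. \<not> P x) U)"
proof -
  define A where "A = {S. B \<subseteq> S \<and> (\<forall>X\<subseteq>S. finite X \<longrightarrow> \<Inter>X \<noteq> {})}"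
  have "\<exists>M\<in>A. \<forall>X\<in>A. M \<subseteq> X \<longrightarrow> X = M"
  proof (rule subset_Zorn_nonempty)
    show "A \<noteq> {}" using B by (auto simp: A_def)
    fix \<C> assume C: "\<C> \<noteq> {}" "subset.chain A \<C>"
    have "\<Inter>X \<noteq> {}" if X: "X \<subseteq> \<Union>\<C>" "finite X" for X
    proof -
      obtain S where "S \<in> \<C>" "X \<subseteq> S"
        using finite_subset_Union_chain[OF X(2,1) C] by blast
      then show ?thesis using C(2) X(2) by (auto simp: A_def subset_chain_def)
    qed
    moreover have "B \<subseteq> \<Union>\<C>"
      using C by (simp add: subset_chain_def A_def subset_iff) (metis ex_in_conv)
    ultimately show "\<Union>\<C> \<in> A" by (simp add: A_def)
  qed
  then obtain M where MA: "M \<in> A" and max: "\<And>X. X \<in> A \<Longrightarrow> M \<subseteq> X \<Longrightarrow> X = M"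
    by (metis (no_types, lifting))
  then have M: "B \<subseteq> M" "\<And>X. X \<subseteq> M \<Longrightarrow> finite X \<Longrightarrow> \<Inter>X \<noteq> {}"
    by (simp_all add: A_def)
  define U where "U = (INF S\<in>M. principal S)"
  have mem: "eventually (\<lambda>x. x \<in> S) U" if "S \<in> M" for S
    unfolding U_def le_principal[symmetric] using that by (rule INF_lower)
  have "U \<noteq> bot"
    unfolding U_def
  proof (rule INF_filter_not_bot)
    fix X assume X: "X \<subseteq> M" "finite X"
    show "(INF S\<in>X. principal S) \<noteq> bot"
      using M(2)[OF X] INF_principal_finite[OF X(2), of "\<lambda>S. S"] by (simp add: principal_eq_bot_iff)
  qed
  moreover have "eventually P U \<or> eventually (\<lambda>x. \<not> P x) U" for P
  proof (cases "{x. P x} \<in> M")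
    case True
    then show ?thesis using mem by fastforce
  next
    case False
    then have "insert {x. P x} M \<notin> A" using max by blast
    then obtain X where X: "X \<subseteq> insert {x. P x} M" "finite X" "\<Inter>X = {}"
      using M(1) unfolding A_def by blast
    \<comment> \<open>By maximality, adding \<open>{x. P x}\<close> to \<open>M\<close> produces a
      finite subfamily \<open>X\<close> with empty intersection. Its other members lie in
      \<open>M\<close>, and \<open>P\<close> fails wherever they all hold.\<close>
    have "eventually (\<lambda>x. \<forall>S\<in>X - {{x. P x}}. x \<in> S) U"
      using X by (auto intro!: eventually_ball_finite mem)
    then have "eventually (\<lambda>x. \<not> P x) U"
      by eventually_elim (use X(3) in blast)
    then show ?thesis ..
  qed
  ultimately show ?thesis using mem M(1) by blast
qed

section \<open>Polynomial functions in arbitrarily many variables and their partial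
  derivatives\<close>

inductive polyfun :: "(('v \<Rightarrow> 'a::comm_ring_1) \<Rightarrow> 'a) \<Rightarrow> bool" where
  const: "polyfun (\<lambda>_. c)"
| var: "polyfun (\<lambda>x. x v)"
| add: "polyfun f \<Longrightarrow> polyfun g \<Longrightarrow> polyfun (\<lambda>x. f x + g x)"
| mult: "polyfun f \<Longrightarrow> polyfun g \<Longrightarrow> polyfun (\<lambda>x. f x * g x)"

text \<open>A relation, because the derivative is read off from the way \<open>f\<close> is built
  up. That over a field of characteristic zero it depends only on the function \<open>f\<close>
  rests on \<open>polyfun_der_zero\<close>.\<close>

inductive polyfun_der :: "'v \<Rightarrow> (('v \<Rightarrow> 'a::comm_ring_1) \<Rightarrow> 'a) \<Rightarrow> (('v \<Rightarrow> 'a) \<Rightarrow> 'a) \<Rightarrow> bool" for v where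
  const: "polyfun_der v (\<lambda>_. c) (\<lambda>_. 0)"
| var: "polyfun_der v (\<lambda>x. x u) (\<lambda>_. if u = v then 1 else 0)"
| add: "polyfun_der v f f' \<Longrightarrow> polyfun_der v g g' \<Longrightarrow> polyfun_der v (\<lambda>x. f x + g x) (\<lambda>x. f' x + g' x)"
| mult: "polyfun_der v f f' \<Longrightarrow> polyfun_der v g g' \<Longrightarrow>
    polyfun_der v (\<lambda>x. f x * g x) (\<lambda>x. f x * g' x + f' x * g x)"

lemma polyfun_der_imp_polyfun: "polyfun_der v f f' \<Longrightarrow> polyfun f"
  by (induction rule: polyfun_der.induct) (auto intro: polyfun.intros)

lemma polyfun_on_line:
  assumes "polyfun f"
  shows "\<exists>P. \<forall>s. f (\<lambda>v. x v + s * y v) = poly P s"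
  using assms
proof induction
  case (const c)
  show ?case by (rule exI[of _ "[:c:]"]) simp
next
  case (var v)
  show ?case by (rule exI[of _ "[:x v, y v:]"]) simp
next
  case (add f g)
  then show ?case by (metis poly_add)
next
  case (mult f g)
  then show ?case by (metis poly_mult)
qed

lemma polyfun_der_on_line:
  assumes "polyfun_der v f f'"
  shows "\<exists>P. \<forall>s. f (x(v := s)) = poly P s \<and> f' (x(v := s)) = poly (pderiv P) s"
  using assms
proof induction
  case (const c)
  show ?case by (rule exI[of _ "[:c:]"]) (simp add: pderiv_pCons)
next
  case (var u)
  show ?case
    by (rule exI[of _ "if u = v then [:0, 1:] else [:x u:]"]) (simp add: pderiv_pCons)
next
  case (add f f' g g')
  then obtain P Q where "\<forall>s. f (x(v := s)) = poly P s \<and> f' (x(v := s)) = poly (pderiv P) s"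
    "\<forall>s. g (x(v := s)) = poly Q s \<and> g' (x(v := s)) = poly (pderiv Q) s" by blast
  then show ?case by (intro exI[of _ "P + Q"]) (simp add: pderiv_add del: fun_upd_apply)
next
  case (mult f f' g g')
  then obtain P Q where "\<forall>s. f (x(v := s)) = poly P s \<and> f' (x(v := s)) = poly (pderiv P) s"
    "\<forall>s. g (x(v := s)) = poly Q s \<and> g' (x(v := s)) = poly (pderiv Q) s" by blast
  then show ?case by (intro exI[of _ "P * Q"]) (simp add: pderiv_mult algebra_simps del: fun_upd_apply)
qed

text \<open>On each line in direction \<open>v\<close> the function is a univariate polynomial. If
  it vanishes on an infinite field, it is the zero polynomial, and so is its derivative.\<close>

lemma polyfun_der_zero:
  fixes f :: "('v \<Rightarrow> 'a::field_char_0) \<Rightarrow> 'a"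
  assumes "polyfun_der v f f'" "\<And>x. f x = 0"
  shows "f' x = 0"
proof -
  obtain P where P: "\<And>s. f (x(v := s)) = poly P s" "\<And>s. f' (x(v := s)) = poly (pderiv P) s"
    using polyfun_der_on_line[OF assms(1)] by blast
  have "P = 0" using P(1) assms(2) poly_all_0_iff_0[of P] by simp
  then show ?thesis using P(2)[of "x v"] by simp
qed

text \<open>Irreducibility of affine space: on the line joining \<open>x\<close> and
  \<open>y\<close> both functions become nonzero univariate polynomials, whose product is nonzero
  and so has a non-root in the infinite field.\<close>

lemma polyfun_mult_nonzero:
  fixes f g :: "('v \<Rightarrow> 'a::field_char_0) \<Rightarrow> 'a"
  assumes "polyfun f" "polyfun g" "f x \<noteq> 0" "g y \<noteq> 0"
  shows "\<exists>w. f w * g w \<noteq> 0"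
proof -
  obtain P where P: "\<And>s. f (\<lambda>v. x v + s * (y v - x v)) = poly P s"
    using polyfun_on_line[OF assms(1), of x "\<lambda>v. y v - x v"] by blast
  obtain Q where Q: "\<And>s. g (\<lambda>v. x v + s * (y v - x v)) = poly Q s"
    using polyfun_on_line[OF assms(2), of x "\<lambda>v. y v - x v"] by blast
  have "P \<noteq> 0" using P[of 0] assms(3) by auto
  moreover have "Q \<noteq> 0" using Q[of 1] assms(4) by auto
  ultimately have "P * Q \<noteq> 0" by simp
  then obtain s where "poly (P * Q) s \<noteq> 0" using poly_all_0_iff_0 by blast
  then show ?thesis
    using P[of s] Q[of s] by (intro exI[of _ "\<lambda>v. x v + s * (y v - x v)"]) auto
qed

lemma ex_generic_ultrafilter:
  "\<exists>U :: ('v \<Rightarrow> 'a::field_char_0) filter. U \<noteq> bot \<and>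
    (\<forall>f. polyfun f \<longrightarrow> (\<exists>x. f x \<noteq> 0) \<longrightarrow> eventually (\<lambda>x. f x \<noteq> 0) U) \<and>
    (\<forall>P. eventually P U \<or> eventually (\<lambda>x. \<not> P x) U)"
proof -
  define B :: "('v \<Rightarrow> 'a) set set" where "B = {{x. f x \<noteq> 0} | f. polyfun f \<and> (\<exists>x. f x \<noteq> 0)}"
  \<comment> \<open>Stronger than nonemptiness so that the induction goes through: a finite
    intersection contains a nonempty basic open set.\<close>
  have ex: "\<exists>f. polyfun f \<and> (\<exists>x. f x \<noteq> 0) \<and> {x. f x \<noteq> 0} \<subseteq> \<Inter>X" if "finite X" "X \<subseteq> B" for X
    using that
  proof (induction X)
    case empty
    show ?case by (intro exI[of _ "\<lambda>_. 1"]) (simp add: polyfun.const)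
  next
    case (insert S X)
    then obtain f x where f: "polyfun f" "f x \<noteq> 0" "{x. f x \<noteq> 0} \<subseteq> \<Inter>X" by auto
    obtain g y where g: "polyfun g" "g y \<noteq> 0" "S = {x. g x \<noteq> 0}"
      using insert.prems by (auto simp: B_def)
    have "{x. f x * g x \<noteq> 0} \<subseteq> \<Inter>(insert S X)"
      using f(3) g(3) by auto
    then show ?case
      using polyfun_mult_nonzero[of f g x y, OF f(1) g(1) f(2) g(2)] polyfun.mult[OF f(1) g(1)]
      by - (rule exI[where x = "\<lambda>x. f x * g x"], rule conjI, assumption, rule conjI)
  qed
  have B: "\<Inter>X \<noteq> {}" if X: "X \<subseteq> B" "finite X" for X
  proof -
    obtain f where f: "polyfun f \<and> (\<exists>x. f x \<noteq> 0) \<and> {x. f x \<noteq> 0} \<subseteq> \<Inter>X"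
      using ex[OF X(2,1)] by (rule exE)
    then obtain x where "f x \<noteq> 0" by auto
    with f have "x \<in> \<Inter>X" by (simp add: subset_iff)
    then show ?thesis by auto
  qed
  from finite_intersection_ultrafilter[of B, OF B] obtain U
    where U: "U \<noteq> bot" "\<forall>S\<in>B. eventually (\<lambda>x. x \<in> S) U"
      "\<forall>P. eventually P U \<or> eventually (\<lambda>x. \<not> P x) U" by auto
  have "eventually (\<lambda>x. f x \<noteq> 0) U" if "polyfun f" "\<exists>x. f x \<noteq> 0" for f
  proof -
    have "{x. f x \<noteq> 0} \<in> B" unfolding B_def mem_Collect_eq
      by (rule exI[where x = f], rule conjI[OF refl], rule conjI[OF that])
    then have "eventually (\<lambda>x. x \<in> {x. f x \<noteq> 0}) U" using U(2) by (rule bspec[rotated])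
    then show ?thesis by simp
  qed
  then show ?thesis using U(1,3) by (intro exI[of _ U] conjI allI impI) simp_all
qed

section \<open>The ultrapower of the ground field along a generic ultrafilter\<close>

definition generic_filter :: "('v \<Rightarrow> 'a::field_char_0) filter" where
  "generic_filter = (SOME U. U \<noteq> bot \<and>
    (\<forall>f. polyfun f \<longrightarrow> (\<exists>x. f x \<noteq> 0) \<longrightarrow> eventually (\<lambda>x. f x \<noteq> 0) U) \<and>
    (\<forall>P. eventually P U \<or> eventually (\<lambda>x. \<not> P x) U))"

lemma generic_filter:
  shows generic_filter_nonbot: "(generic_filter :: ('v \<Rightarrow> 'a::field_char_0) filter) \<noteq> bot"
    and generic_filter_polyfun: "\<And>f :: ('v \<Rightarrow> 'a) \<Rightarrow> 'a. polyfun f \<Longrightarrow> f y \<noteq> 0 \<Longrightarrow>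
      eventually (\<lambda>x. f x \<noteq> 0) generic_filter"
    and generic_filter_ultra: "\<And>P :: ('v \<Rightarrow> 'a) \<Rightarrow> bool.
      \<not> eventually P generic_filter \<Longrightarrow> eventually (\<lambda>x. \<not> P x) generic_filter"
  using someI_ex[OF ex_generic_ultrafilter, folded generic_filter_def] by metis+

\<comment> \<open>The index set of the ultrapower is the affine space
  \<open>'v \<Rightarrow> 'a\<close> itself, so an arbitrary choice made at every point defines a
  single element.\<close>
quotient_type (overloaded) ('v, 'a) gfun = "('v \<Rightarrow> 'a::field_char_0) \<Rightarrow> 'a" /
  "\<lambda>f g. eventually (\<lambda>x. f x = g x) generic_filter"
proof (rule equivpI)
  show "reflp (\<lambda>f g :: ('v \<Rightarrow> 'a) \<Rightarrow> 'a. eventually (\<lambda>x. f x = g x) generic_filter)"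
    by (simp add: reflp_def)
  show "symp (\<lambda>f g :: ('v \<Rightarrow> 'a) \<Rightarrow> 'a. eventually (\<lambda>x. f x = g x) generic_filter)"
    by (simp add: symp_def eq_commute)
  show "transp (\<lambda>f g :: ('v \<Rightarrow> 'a) \<Rightarrow> 'a. eventually (\<lambda>x. f x = g x) generic_filter)"
    by (rule transpI) (erule (1) eventually_elim2, simp)
qed

instantiation gfun :: (type, field_char_0) comm_ring_1
begin

lift_definition zero_gfun :: "('a, 'b) gfun" is "\<lambda>_. 0" .
lift_definition one_gfun :: "('a, 'b) gfun" is "\<lambda>_. 1" .
lift_definition plus_gfun :: "('a, 'b) gfun \<Rightarrow> ('a, 'b) gfun \<Rightarrow> ('a, 'b) gfun" is "\<lambda>f g x. f x + g x"
  by (erule (1) eventually_elim2) simp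
lift_definition minus_gfun :: "('a, 'b) gfun \<Rightarrow> ('a, 'b) gfun \<Rightarrow> ('a, 'b) gfun" is "\<lambda>f g x. f x - g x"
  by (erule (1) eventually_elim2) simp
lift_definition times_gfun :: "('a, 'b) gfun \<Rightarrow> ('a, 'b) gfun \<Rightarrow> ('a, 'b) gfun" is "\<lambda>f g x. f x * g x"
  by (erule (1) eventually_elim2) simp
lift_definition uminus_gfun :: "('a, 'b) gfun \<Rightarrow> ('a, 'b) gfun" is "\<lambda>f x. - f x"
  by (erule eventually_mono) simp

instance
proof
  fix a b c :: "('a, 'b) gfun"
  show "a + b + c = a + (b + c)" by transfer (simp add: algebra_simps)
  show "a + b = b + a" by transfer (simp add: algebra_simps)
  show "0 + a = a" by transfer simp
  show "- a + a = 0" by transfer simp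
  show "a - b = a + - b" by transfer simp
  show "a * b * c = a * (b * c)" by transfer (simp add: algebra_simps)
  show "a * b = b * a" by transfer (simp add: algebra_simps)
  show "1 * a = a" by transfer simp
  show "(a + b) * c = a * c + b * c" by transfer (simp add: algebra_simps)
  show "(0::('a, 'b) gfun) \<noteq> 1"
    by transfer (simp add: generic_filter_nonbot trivial_limit_def[symmetric])
qed

end

instantiation gfun :: (type, field_char_0) field
begin

lift_definition divide_gfun :: "('a, 'b) gfun \<Rightarrow> ('a, 'b) gfun \<Rightarrow> ('a, 'b) gfun" is "\<lambda>f g x. f x / g x"
  by (erule (1) eventually_elim2) simp
lift_definition inverse_gfun :: "('a, 'b) gfun \<Rightarrow> ('a, 'b) gfun" is "\<lambda>f x. inverse (f x)"
  by (erule eventually_mono) simp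

instance
proof
  fix a b :: "('a, 'b) gfun"
  show "inverse a * a = 1" if "a \<noteq> 0"
    \<comment> \<open>The ultrafilter property: a function that is not eventually zero is eventually
      nonzero.\<close>
    using that by transfer (drule generic_filter_ultra, erule eventually_mono, simp)
  show "a div b = a * inverse b" by transfer (simp add: field_simps)
  show "inverse (0::('a, 'b) gfun) = 0" by transfer simp
qed

end

lift_definition gconst :: "'a::field_char_0 \<Rightarrow> ('v, 'a) gfun" is "\<lambda>c _. c" .

text \<open>The generic coordinates. They are algebraically independent over the constants
  \<open>gconst\<close>, since a polynomial function that is not identically zero is eventually
  nonzero.\<close>

lift_definition gvar :: "'v \<Rightarrow> ('v, 'a::field_char_0) gfun" is "\<lambda>v x. x v" .

lemma abs_gfun_eq_iff:
  "abs_gfun f = abs_gfun g \<longleftrightarrow> eventually (\<lambda>x. f x = g x) generic_filter"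
  by (rule gfun.abs_eq_iff)

lemma abs_gfun_add: "abs_gfun (\<lambda>x. f x + g x) = abs_gfun f + abs_gfun g"
  by (simp add: plus_gfun.abs_eq)

lemma abs_gfun_mult: "abs_gfun (\<lambda>x. f x * g x) = abs_gfun f * abs_gfun g"
  by (simp add: times_gfun.abs_eq)

lemma abs_gfun_const: "abs_gfun (\<lambda>_. c) = gconst c"
  by (simp add: gconst.abs_eq)

lemma abs_gfun_var: "abs_gfun (\<lambda>x. x v) = gvar v"
  by (simp add: gvar.abs_eq)

lemma gconst_eq_iff: "gconst a = gconst b \<longleftrightarrow> a = b"
  by transfer (simp add: generic_filter_nonbot trivial_limit_def[symmetric])

lemma gconst_simps: "gconst 0 = 0" "gconst 1 = 1" "gconst (a + b) = gconst a + gconst b"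
  "gconst (a * b) = gconst a * gconst b" "gconst (- a) = - gconst a"
  by (transfer; simp)+

lemma abs_gfun_sum: "abs_gfun (\<lambda>x. \<Sum>i\<in>A. f i x) = (\<Sum>i\<in>A. abs_gfun (f i))"
  by (induction A rule: infinite_finite_induct)
     (simp_all add: abs_gfun_add abs_gfun_const gconst_simps)

lemma abs_gfun_prod: "abs_gfun (\<lambda>x. \<Prod>i\<in>A. f i x) = (\<Prod>i\<in>A. abs_gfun (f i))"
  by (induction A rule: infinite_finite_induct)
     (simp_all add: abs_gfun_mult abs_gfun_const gconst_simps)

text \<open>The extension of derivations is applied to the ultrapower and needs its characteristic
  to be zero; this follows from the injectivity of \<open>gconst\<close>.\<close>

instance gfun :: (type, field_char_0) field_char_0
proof
  have "(of_nat n :: ('a, 'b) gfun) = gconst (of_nat n)" for n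
    by (induction n) (simp_all add: gconst_simps)
  then show "inj (of_nat :: nat \<Rightarrow> ('a, 'b) gfun)"
    by (simp add: inj_def gconst_eq_iff)
qed

text \<open>The point is well-definedness: a polynomial function that represents 0 in the ultrapower
  must vanish identically by genericity, hence so does its derivative.\<close>

lemma der_graph_polyfun:
  fixes v :: 'v
  defines "G \<equiv> {(abs_gfun f, abs_gfun f') | f f'. polyfun_der v f f'} ::
    (('v, 'a::field_char_0) gfun \<times> ('v, 'a) gfun) set"
  shows "der_graph G"
proof -
  have I: "(a, b) \<in> G" if "polyfun_der v f f'" "a = abs_gfun f" "b = abs_gfun f'" for a b f f'
    using that unfolding G_def by blast
  have c: "(gconst c, 0) \<in> G" for c
    by (rule I[OF polyfun_der.const[of v c]]) (simp_all add: abs_gfun_const gconst_simps)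
  have "(0, 0) \<in> G" "(1, 0) \<in> G" "(-1, 0) \<in> G"
    using c[of 0] c[of 1] c[of "-1"] by (simp_all only: gconst_simps)
  moreover have "(a + b, a' + b') \<in> G \<and> (a * b, a * b' + a' * b) \<in> G"
    if ab: "(a, a') \<in> G" "(b, b') \<in> G" for a a' b b'
  proof -
    obtain f f' g g' where fg: "polyfun_der v f f'" "polyfun_der v g g'"
      "a = abs_gfun f" "a' = abs_gfun f'" "b = abs_gfun g" "b' = abs_gfun g'"
      using ab unfolding G_def by auto
    show ?thesis
      by (intro conjI I[OF polyfun_der.add[OF fg(1,2)]] I[OF polyfun_der.mult[OF fg(1,2)]])
         (simp_all add: fg abs_gfun_add abs_gfun_mult)
  qed
  moreover have "b = 0" if b: "(0, b) \<in> G" for b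
  proof -
    obtain f f' where f: "polyfun_der v f f'" "abs_gfun f = 0" "b = abs_gfun f'"
      using b unfolding G_def by auto
    have ev: "eventually (\<lambda>x. f x = 0) generic_filter"
      using f(2) by (simp add: zero_gfun_def abs_gfun_eq_iff)
    have "f x = 0" for x
    proof (rule ccontr)
      assume "f x \<noteq> 0"
      then have "eventually (\<lambda>x. f x \<noteq> 0) generic_filter"
        by (rule generic_filter_polyfun[OF polyfun_der_imp_polyfun[OF f(1)]])
      from eventually_happens'[OF generic_filter_nonbot eventually_conj[OF ev this]] show False
        by blast
    qed
    then have "f' = (\<lambda>_. 0)" using polyfun_der_zero[OF f(1)] by blast
    then show "b = 0" using f(3) by (simp add: zero_gfun_def)
  qed
  ultimately show ?thesis unfolding der_graph_def by blast
qed

definition derivation :: "('k::comm_ring \<Rightarrow> 'k) \<Rightarrow> bool" where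
  "derivation D \<longleftrightarrow> (\<forall>a b. D (a + b) = D a + D b \<and> D (a * b) = a * D b + D a * b)"

text \<open>The derivation acts on the whole ultrapower, so it also applies to entries that are
  chosen pointwise and need not be polynomial in the coordinates.\<close>

lemma ex_partial_derivative:
  "\<exists>D :: ('v, 'a::field_char_0) gfun \<Rightarrow> ('v, 'a) gfun. derivation D \<and>
    (\<forall>c. D (gconst c) = 0) \<and> (\<forall>u. D (gvar u) = (if u = v then 1 else 0))"
proof -
  let ?G = "{(abs_gfun f, abs_gfun f') | f f'. polyfun_der v f f'} :: (('v, 'a) gfun \<times> ('v, 'a) gfun) set"
  obtain D :: "('v, 'a) gfun \<Rightarrow> ('v, 'a) gfun" where D: "\<forall>a b. D (a + b) = D a + D b"
    "\<forall>a b. D (a * b) = a * D b + D a * b" "\<forall>(a, b)\<in>?G. D a = b"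
    using der_graph_total_extension[OF der_graph_polyfun[of v]] by blast
  have val: "D (abs_gfun f) = abs_gfun f'" if "polyfun_der v f f'" for f f'
    using D(3) that by auto
  have "D (gconst c) = 0" for c
    using val[OF polyfun_der.const[of v c]] by (simp add: abs_gfun_const gconst_simps)
  moreover have "D (gvar u) = (if u = v then 1 else 0)" for u
    using val[OF polyfun_der.var[of v u]] by (simp add: abs_gfun_const abs_gfun_var gconst_simps)
  ultimately show ?thesis using D(1,2) unfolding derivation_def by blast
qed

section \<open>Iterated derivatives of products\<close>

lemma derivationD:
  assumes "derivation D"
  shows "D (a + b) = D a + D b" "D (a * b) = a * D b + D a * b"
  using assms unfolding derivation_def by blast+

lemma derivation_zero: "derivation D \<Longrightarrow> D 0 = 0"
  using derivationD(1)[of D 0 0] by simp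

lemma derivation_sum:
  assumes "derivation D"
  shows "D (\<Sum>i\<in>A. f i) = (\<Sum>i\<in>A. D (f i))"
  by (induction A rule: infinite_finite_induct)
     (simp_all add: derivationD[OF assms] derivation_zero[OF assms])

lemma derivation_one:
  fixes D :: "'k::comm_ring_1 \<Rightarrow> 'k"
  assumes "derivation D"
  shows "D 1 = 0"
  using derivationD(2)[OF assms, of 1 1] by simp

lemma derivation_prod:
  fixes D :: "'k::comm_ring_1 \<Rightarrow> 'k"
  assumes "derivation D" "finite A"
  shows "D (\<Prod>j\<in>A. a j) = (\<Sum>l\<in>A. \<Prod>j\<in>A. if j = l then D (a j) else a j)"
  using assms(2)
proof (induction A)
  case empty
  then show ?case by (simp add: derivation_one[OF assms(1)])
next
  case (insert x A)
  have "(\<Prod>j\<in>A. if j = x then D (a j) else a j) = (\<Prod>j\<in>A. a j)"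
    using insert by (intro prod.cong) auto
  moreover have "(\<Sum>l\<in>A. (if x = l then D (a x) else a x) * (\<Prod>j\<in>A. if j = l then D (a j) else a j))
      = a x * (\<Sum>l\<in>A. \<Prod>j\<in>A. if j = l then D (a j) else a j)"
    unfolding sum_distrib_left using insert by (intro sum.cong) auto
  ultimately show ?case
    using insert by (simp add: derivationD(2)[OF assms(1)] algebra_simps)
qed

lemma derivation_prod_zero:
  fixes D :: "'k::comm_ring_1 \<Rightarrow> 'k"
  assumes "derivation D" "\<And>j. j \<in> A \<Longrightarrow> D (a j) = 0"
  shows "D (\<Prod>j\<in>A. a j) = 0"
  using assms(2)
  by (induction A rule: infinite_finite_induct)
     (simp_all add: derivation_one[OF assms(1)] derivationD(2)[OF assms(1)])

text \<open>Applies \<open>D l\<close> for \<open>l \<in> S\<close> with \<open>l < p\<close>, in increasing order, since the derivations need not commute.\<close>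

primrec iter_der :: "(nat \<Rightarrow> 'k \<Rightarrow> 'k) \<Rightarrow> nat set \<Rightarrow> nat \<Rightarrow> 'k \<Rightarrow> 'k" where
  "iter_der D S 0 a = a"
| "iter_der D S (Suc p) a = (if p \<in> S then D p (iter_der D S p a) else iter_der D S p a)"

lemma iter_der_cong:
  assumes "\<And>l. l < p \<Longrightarrow> l \<in> S \<longleftrightarrow> l \<in> S'" "\<And>l. l < p \<Longrightarrow> l \<in> S \<Longrightarrow> D l = D' l"
  shows "iter_der D S p a = iter_der D' S' p a"
  using assms by (induction p) auto

lemma iter_der_sum:
  assumes "\<And>p. derivation (D p)"
  shows "iter_der D S p (\<Sum>i\<in>A. f i) = (\<Sum>i\<in>A. iter_der D S p (f i))"
  by (induction p) (simp_all add: derivation_sum[OF assms])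

lemma sum_PiE_lessThan_Suc:
  "(\<Sum>f\<in>{..<Suc p} \<rightarrow>\<^sub>E B. g f) = (\<Sum>f\<in>{..<p} \<rightarrow>\<^sub>E B. \<Sum>l\<in>B. g (f(p := l)))"
proof -
  have inj: "inj_on (\<lambda>(y, f). f(p := y)) (B \<times> ({..<p} \<rightarrow>\<^sub>E B))"
    using inj_combinator[of p "{..<p}" "\<lambda>_. B"] by simp
  have "{..<Suc p} \<rightarrow>\<^sub>E B = (\<lambda>(y, f). f(p := y)) ` (B \<times> ({..<p} \<rightarrow>\<^sub>E B))"
    by (simp add: lessThan_Suc PiE_insert_eq)
  then have "(\<Sum>f\<in>{..<Suc p} \<rightarrow>\<^sub>E B. g f) = (\<Sum>(y, f)\<in>B \<times> ({..<p} \<rightarrow>\<^sub>E B). g (f(p := y)))"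
    using sum.reindex[OF inj, of g] by (simp add: case_prod_unfold comp_def)
  also have "\<dots> = (\<Sum>f\<in>{..<p} \<rightarrow>\<^sub>E B. \<Sum>l\<in>B. g (f(p := l)))"
    unfolding sum.cartesian_product[symmetric] by (rule sum.swap)
  finally show ?thesis .
qed

text \<open>The iterated Leibniz rule; \<open>f\<close> records which of the \<open>k\<close>
  factors receives the derivative with number \<open>l\<close>.\<close>

lemma iter_der_prod:
  fixes D :: "nat \<Rightarrow> 'k::comm_ring_1 \<Rightarrow> 'k" and k :: nat
  assumes "\<And>p. derivation (D p)"
  shows "iter_der D UNIV p (\<Prod>j<k. a j) =
    (\<Sum>f\<in>{..<p} \<rightarrow>\<^sub>E {..<k}. \<Prod>j<k. iter_der D {l. f l = j} p (a j))"
proof (induction p)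
  case 0
  then show ?case by simp
next
  case (Suc p)
  have upd: "iter_der D {l. (f(p := l')) l = j} (Suc p) (a j) =
      (if j = l' then D p (iter_der D {l. f l = j} p (a j)) else iter_der D {l. f l = j} p (a j))" for f l' j
  proof -
    have "iter_der D {l. (f(p := l')) l = j} p x = iter_der D {l. f l = j} p x" for x
      by (rule iter_der_cong) auto
    then show ?thesis by (simp only: iter_der.simps mem_Collect_eq fun_upd_same) auto
  qed
  have "iter_der D UNIV (Suc p) (\<Prod>j<k. a j) =
      (\<Sum>f\<in>{..<p} \<rightarrow>\<^sub>E {..<k}. D p (\<Prod>j<k. iter_der D {l. f l = j} p (a j)))"
    by (simp add: Suc derivation_sum[OF assms])
  then show ?case
    unfolding sum_PiE_lessThan_Suc upd derivation_prod[OF assms finite_lessThan] .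
qed

text \<open>Each derivation removes one variable of the multilinear monomial or kills it. For
  \<open>p = d\<close> this extracts the coefficient belonging to the multi-index
  \<open>I\<close>.\<close>

lemma iter_der_monomial:
  fixes X :: "nat \<Rightarrow> 'i \<Rightarrow> 'k::comm_ring_1"
  assumes D: "\<And>p. derivation (D p)"
    and c: "\<And>p. D p c = 0"
    and X: "\<And>p q i. D p (X q i) = (if q = p \<and> i = I p then 1 else 0)"
    and "p \<le> d"
  shows "iter_der D UNIV p ((\<Prod>l<d. X l (J l)) * c) =
    (if \<forall>l<p. J l = I l then (\<Prod>l\<in>{p..<d}. X l (J l)) * c else 0)"
  using \<open>p \<le> d\<close>
proof (induction p)
  case 0
  then show ?case by (simp add: atLeast0LessThan)
next
  case (Suc p)
  have "D p (\<Prod>l\<in>{Suc p..<d}. X l (J l)) = 0"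
    by (rule derivation_prod_zero[OF D]) (simp add: X)
  moreover have "{p..<d} = insert p {Suc p..<d}"
    using Suc.prems by auto
  ultimately have "D p ((\<Prod>l\<in>{p..<d}. X l (J l)) * c) =
      (if J p = I p then (\<Prod>l\<in>{Suc p..<d}. X l (J l)) * c else 0)"
    by (simp add: derivationD(2)[OF D] X c)
  then show ?case
    using Suc by (auto simp: derivation_zero[OF D] less_Suc_eq)
qed

section \<open>Transfer of decompositions\<close>

text \<open>The \<open>k\<close> fibres partition \<open>d\<close> points; if each had fewer than
  \<open>d / k\<close> points, they could not add up to \<open>d\<close>.\<close>

lemma pigeonhole_fibre:
  assumes "k \<ge> 1" "f \<in> {..<d} \<rightarrow> {..<k}"
  shows "\<exists>j<k. d \<le> k * card {l. l < d \<and> f l = j}"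
proof (rule ccontr)
  assume "\<not> ?thesis"
  then have lt: "\<And>j. j < k \<Longrightarrow> k * card {l. l < d \<and> f l = j} < d"
    by (meson not_le)
  have "(\<Sum>j<k. card {l \<in> {..<d}. f l = j}) = card {..<d}"
    using assms(2) sum.group[of "{..<d}" "{..<k}" f "\<lambda>_. 1::nat"] by auto
  then have "k * d = (\<Sum>j<k. k * card {l. l < d \<and> f l = j})"
    by (simp add: sum_distrib_left[symmetric])
  also have "\<dots> < (\<Sum>j<k. d)"
    using lt assms(1) by (intro sum_strict_mono) (auto simp: lessThan_empty_iff)
  finally show False by simp
qed

text \<open>Here \<open>i\<close> numbers the simple tensors, \<open>f\<close> is a distribution of
  the derivatives, and \<open>loc\<close> says that factor \<open>j\<close> sees only the entries of
  \<open>I\<close> assigned to it. Summation over the entries assigned to a heavy factor can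
  therefore be done inside that factor, and only the other entries still cost summands.\<close>

lemma sum_of_products_regroup:
  fixes b :: "nat \<Rightarrow> (nat \<Rightarrow> nat) \<Rightarrow> nat \<Rightarrow> (nat \<Rightarrow> nat) \<Rightarrow> 'y \<Rightarrow> 'k::comm_ring_1"
  assumes k: "k \<ge> 1" and n: "n \<ge> 1"
    and loc: "\<And>i f j I I'. (\<And>l. l < d \<Longrightarrow> f l = j \<Longrightarrow> I l = I' l) \<Longrightarrow> b i f j I = b i f j I'"
  shows "\<exists>(Q :: (nat \<times> (nat \<Rightarrow> nat) \<times> (nat \<Rightarrow> nat)) set) v. finite Q \<and>
    card Q \<le> r * (k ^ d * n ^ ((k - 1) * d div k)) \<and>
    (\<forall>y. (\<Sum>I\<in>{..<d} \<rightarrow>\<^sub>E {..<n}. t I *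
        (\<Sum>i<r. \<Sum>f\<in>{..<d} \<rightarrow>\<^sub>E {..<k}. \<Prod>j<k. b i f j I (y j))) =
      (\<Sum>q\<in>Q. \<Prod>j<k. v q j (y j)))"
proof -
  let ?F = "{..<d} \<rightarrow>\<^sub>E {..<k}" and ?P = "{..<d} \<rightarrow>\<^sub>E {..<n}"
  have "\<exists>j. f \<in> ?F \<longrightarrow> j < k \<and> d \<le> k * card {l. l < d \<and> f l = j}" for f
    using pigeonhole_fibre[OF k, of f d] by (auto simp: PiE_def)
  then obtain j0 where j0: "\<And>f. f \<in> ?F \<Longrightarrow> j0 f < k \<and> d \<le> k * card {l. l < d \<and> f l = j0 f}"
    by metis
  \<comment> \<open>The positions whose derivative goes to a factor other than the heavy one
    \<open>j0 f\<close>.\<close>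
  define R where "R f = {l. l < d \<and> f l \<noteq> j0 f}" for f
  have finR: "finite (R f)" for f by (simp add: R_def)
  define e where "e = (k - 1) * d div k"
  have cardR: "card (R f) \<le> e" if "f \<in> ?F" for f
  proof -
    have "{l. l < d \<and> f l = j0 f} \<union> R f = {..<d}" by (auto simp: R_def)
    moreover have "card ({l. l < d \<and> f l = j0 f} \<union> R f) = card {l. l < d \<and> f l = j0 f} + card (R f)"
      by (rule card_Un_disjoint) (auto simp: R_def)
    ultimately have "k * card {l. l < d \<and> f l = j0 f} + k * card (R f) = k * d"
      by (metis card_lessThan distrib_left)
    then have "card (R f) * k \<le> (k - 1) * d"
      using j0[OF that] mult.commute[of "card (R f)" k] by (simp only: diff_mult_distrib) linarith
    then show ?thesis using k by (simp add: e_def less_eq_div_iff_mult_less_eq)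
  qed
  let ?J = "\<lambda>f. R f \<rightarrow>\<^sub>E {..<n}"
  define Q where "Q = (SIGMA i:{..<r}. SIGMA f:?F. ?J f)"
  \<comment> \<open>The heavy factor absorbs the scalars \<open>t I\<close> and the sum over all
    \<open>I\<close> that restrict to \<open>J\<close>; the other factors can be evaluated at
    \<open>J\<close> itself.\<close>
  define v where "v = (\<lambda>(i, f, J) j y. if j = j0 f
      then (\<Sum>I\<in>{I \<in> ?P. restrict I (R f) = J}. t I * b i f j I y) else b i f j J y)"
  have fin: "finite ?F" "finite ?P" "\<And>f. finite (?J f)"
    by (auto intro!: finite_PiE simp: finR)
  have "card Q = (\<Sum>i<r. \<Sum>f\<in>?F. n ^ card (R f))"
    unfolding Q_def by (simp add: fin finite_SigmaI card_PiE finR)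
  also have "\<dots> \<le> (\<Sum>i<r. \<Sum>f\<in>?F. n ^ e)"
    using n by (intro sum_mono power_increasing cardR) auto
  also have "\<dots> = r * (k ^ d * n ^ e)" by (simp add: card_PiE)
  finally have "card Q \<le> r * (k ^ d * n ^ e)" .
  moreover have "finite Q" unfolding Q_def by (intro finite_SigmaI fin) auto
  moreover have "(\<Sum>I\<in>?P. t I * (\<Sum>i<r. \<Sum>f\<in>?F. \<Prod>j<k. b i f j I (y j))) =
      (\<Sum>q\<in>Q. \<Prod>j<k. v q j (y j))" for y
  proof -
    have step: "(\<Sum>I\<in>?P. t I * (\<Prod>j<k. b i f j I (y j))) = (\<Sum>J\<in>?J f. \<Prod>j<k. v (i, f, J) j (y j))"
      if f: "f \<in> ?F" for i f
    proof -
      have j0k: "j0 f \<in> {..<k}" using j0[OF f] by simp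
      have "(\<lambda>I. restrict I (R f)) ` ?P \<subseteq> ?J f"
      proof (intro image_subsetI)
        fix I assume "I \<in> ?P"
        then have "I l \<in> {..<n}" if "l \<in> R f" for l
          using PiE_mem[of I "{..<d}" "\<lambda>_. {..<n}" l] that by (simp add: R_def)
        then show "restrict I (R f) \<in> ?J f" by (simp add: restrict_PiE_iff)
      qed
      note group = sum.group[OF fin(2,3) this, symmetric]
      have "(\<Sum>I\<in>?P. t I * (\<Prod>j<k. b i f j I (y j))) =
          (\<Sum>J\<in>?J f. \<Sum>I\<in>{I \<in> ?P. restrict I (R f) = J}. t I * (\<Prod>j<k. b i f j I (y j)))"
        by (rule group)
      also have "\<dots> = (\<Sum>J\<in>?J f. \<Prod>j<k. v (i, f, J) j (y j))"
      proof (rule sum.cong[OF refl])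
        fix J
        have "(\<Sum>I\<in>{I \<in> ?P. restrict I (R f) = J}. t I * (\<Prod>j<k. b i f j I (y j))) =
          (\<Sum>I\<in>{I \<in> ?P. restrict I (R f) = J}.
            t I * b i f (j0 f) I (y (j0 f)) * (\<Prod>j\<in>{..<k} - {j0 f}. b i f j J (y j)))"
        proof (rule sum.cong[OF refl])
          fix I assume I: "I \<in> {I \<in> ?P. restrict I (R f) = J}"
          then have J: "J = restrict I (R f)" by simp
          \<comment> \<open>The positions assigned to \<open>j \<noteq> j0 f\<close> all lie in
            \<open>R f\<close>, where \<open>I\<close> and \<open>J\<close> agree.\<close>
          have "b i f j I = b i f j J" if "j \<noteq> j0 f" for j
            unfolding J by (rule loc) (use that in \<open>simp add: R_def\<close>)
          then have "(\<Prod>j\<in>{..<k} - {j0 f}. b i f j I (y j)) = (\<Prod>j\<in>{..<k} - {j0 f}. b i f j J (y j))"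
            by (intro prod.cong) auto
          then show "t I * (\<Prod>j<k. b i f j I (y j)) =
              t I * b i f (j0 f) I (y (j0 f)) * (\<Prod>j\<in>{..<k} - {j0 f}. b i f j J (y j))"
            by (simp add: prod.remove[OF _ j0k] mult.assoc)
        qed
        also have "\<dots> = (\<Prod>j<k. v (i, f, J) j (y j))"
          by (simp add: prod.remove[OF _ j0k] v_def sum_distrib_right)
        finally show "(\<Sum>I\<in>{I \<in> ?P. restrict I (R f) = J}. t I * (\<Prod>j<k. b i f j I (y j))) =
          (\<Prod>j<k. v (i, f, J) j (y j))" .
      qed
      finally show ?thesis .
    qed
    have "(\<Sum>I\<in>?P. t I * (\<Sum>i<r. \<Sum>f\<in>?F. \<Prod>j<k. b i f j I (y j))) =
        (\<Sum>I\<in>?P. \<Sum>i<r. \<Sum>f\<in>?F. t I * (\<Prod>j<k. b i f j I (y j)))"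
      by (simp add: sum_distrib_left)
    also have "\<dots> = (\<Sum>i<r. \<Sum>I\<in>?P. \<Sum>f\<in>?F. t I * (\<Prod>j<k. b i f j I (y j)))"
      by (rule sum.swap)
    also have "\<dots> = (\<Sum>i<r. \<Sum>f\<in>?F. \<Sum>I\<in>?P. t I * (\<Prod>j<k. b i f j I (y j)))"
      by (rule sum.cong[OF refl], rule sum.swap)
    also have "\<dots> = (\<Sum>i<r. \<Sum>f\<in>?F. \<Sum>J\<in>?J f. \<Prod>j<k. v (i, f, J) j (y j))"
      by (rule sum.cong[OF refl], rule sum.cong[OF refl], rule step)
    also have "\<dots> = (\<Sum>q\<in>Q. \<Prod>j<k. v q j (y j))"
      unfolding Q_def by (simp add: sum.Sigma fin finite_SigmaI case_prod_unfold)
    finally show ?thesis .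
  qed
  ultimately show ?thesis unfolding e_def by blast
qed

text \<open>Finitely many identities in the ultrapower hold simultaneously at some point, and
  evaluating representatives there returns them to the ground field.\<close>

lemma specialise_decomposition:
  fixes v :: "'q \<Rightarrow> nat \<Rightarrow> nat \<Rightarrow> ('v, 'a::field_char_0) gfun"
  assumes "finite Y" "\<And>ys. ys \<in> Y \<Longrightarrow> gconst (u ys) = (\<Sum>q\<in>Q. \<Prod>j<k. v q j (ys ! j))"
  shows "\<exists>w. \<forall>ys\<in>Y. u ys = (\<Sum>q\<in>Q. \<Prod>j<k. w q j (ys ! j))"
proof -
  have rep: "abs_gfun (rep_gfun z) = z" for z :: "('v, 'a) gfun"
    by (rule Quotient3_abs_rep[OF Quotient3_gfun])
  have "eventually (\<lambda>x. u ys = (\<Sum>q\<in>Q. \<Prod>j<k. rep_gfun (v q j (ys ! j)) x)) generic_filter"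
    if "ys \<in> Y" for ys
    using assms(2)[OF that]
    by (simp add: abs_gfun_eq_iff[symmetric] abs_gfun_const abs_gfun_sum abs_gfun_prod rep)
  then have "eventually (\<lambda>x. \<forall>ys\<in>Y. u ys = (\<Sum>q\<in>Q. \<Prod>j<k. rep_gfun (v q j (ys ! j)) x)) generic_filter"
    using assms(1) by (simp add: eventually_ball_finite)
  from eventually_happens'[OF generic_filter_nonbot this] obtain x
    where "\<forall>ys\<in>Y. u ys = (\<Sum>q\<in>Q. \<Prod>j<k. rep_gfun (v q j (ys ! j)) x)" ..
  then show ?thesis by (intro exI[of _ "\<lambda>q j i. rep_gfun (v q j i) x"])
qed

text \<open>In the application \<open>c J\<close> is the image of the basis tensor with index
  \<open>J\<close>, \<open>x (l, i)\<close> is coordinate \<open>i\<close> of vector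
  \<open>l\<close>, and \<open>t\<close> holds the coefficients of the tensor to be bounded.\<close>

lemma decomposition_transfer:
  fixes c :: "(nat \<Rightarrow> nat) \<Rightarrow> nat list \<Rightarrow> 'a::field_char_0"
  assumes k: "k \<ge> 1" and n: "n \<ge> 1" and Y: "finite Y"
    and pointwise: "\<And>x. \<exists>a. \<forall>ys\<in>Y.
      (\<Sum>J\<in>{..<d} \<rightarrow>\<^sub>E {..<n}. (\<Prod>l<d. x (l, J l)) * c J ys) = (\<Sum>i<r. \<Prod>j<k. a i j (ys ! j))"
  shows "\<exists>(Q :: (nat \<times> (nat \<Rightarrow> nat) \<times> (nat \<Rightarrow> nat)) set) w. finite Q \<and>
    card Q \<le> r * (k ^ d * n ^ ((k - 1) * d div k)) \<and>
    (\<forall>ys\<in>Y. (\<Sum>J\<in>{..<d} \<rightarrow>\<^sub>E {..<n}. t J * c J ys) = (\<Sum>q\<in>Q. \<Prod>j<k. w q j (ys ! j)))"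
proof -
  let ?F = "{..<d} \<rightarrow>\<^sub>E {..<k}" and ?P = "{..<d} \<rightarrow>\<^sub>E {..<n}"
  have "\<exists>a. \<forall>x. \<forall>ys\<in>Y.
      (\<Sum>J\<in>?P. (\<Prod>l<d. x (l, J l)) * c J ys) = (\<Sum>i<r. \<Prod>j<k. a x i j (ys ! j))"
    by (intro choice allI pointwise)
  then obtain a where a: "\<And>x ys. ys \<in> Y \<Longrightarrow>
      (\<Sum>J\<in>?P. (\<Prod>l<d. x (l, J l)) * c J ys) = (\<Sum>i<r. \<Prod>j<k. a x i j (ys ! j))"
    by blast
  \<comment> \<open>The decompositions chosen at the points \<open>x\<close> are bundled into one
    over the ultrapower, with no regularity in \<open>x\<close>.\<close>
  define A :: "nat \<Rightarrow> nat \<Rightarrow> nat \<Rightarrow> (nat \<times> nat, 'a) gfun"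
    where "A i j y = abs_gfun (\<lambda>x. a x i j y)" for i j y
  have generic: "(\<Sum>J\<in>?P. (\<Prod>l<d. gvar (l, J l)) * gconst (c J ys)) = (\<Sum>i<r. \<Prod>j<k. A i j (ys ! j))"
    if "ys \<in> Y" for ys
  proof -
    have "abs_gfun (\<lambda>x. \<Sum>J\<in>?P. (\<Prod>l<d. x (l, J l)) * c J ys) =
        abs_gfun (\<lambda>x. \<Sum>i<r. \<Prod>j<k. a x i j (ys ! j))"
      by (simp add: a[OF that])
    then show ?thesis
      by (simp add: abs_gfun_sum abs_gfun_mult abs_gfun_prod abs_gfun_var abs_gfun_const A_def)
  qed
  obtain D :: "nat \<times> nat \<Rightarrow> (nat \<times> nat, 'a) gfun \<Rightarrow> (nat \<times> nat, 'a) gfun"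
    where D: "\<And>v. derivation (D v)" "\<And>v c. D v (gconst c) = 0"
      "\<And>v u. D v (gvar u) = (if u = v then 1 else 0)"
    using ex_partial_derivative by metis
  define b where "b i f j I y = iter_der (\<lambda>l. D (l, I l)) {l. f l = j} d (A i j y)" for i f j I y
  \<comment> \<open>Differentiating the generic identity once in each variable
    \<open>(l, I l)\<close>: the left side leaves the coefficient of \<open>I\<close>, the right
    side expands by Leibniz.\<close>
  have coefficient: "gconst (c I ys) = (\<Sum>i<r. \<Sum>f\<in>?F. \<Prod>j<k. b i f j I (ys ! j))"
    if ys: "ys \<in> Y" and I: "I \<in> ?P" for ys I
  proof -
    let ?E = "iter_der (\<lambda>l. D (l, I l)) UNIV d"
    have agree: "(\<forall>l<d. J l = I l) \<longleftrightarrow> J = I" if "J \<in> ?P" for J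
      using PiE_ext[OF that I] by auto
    have "?E (\<Sum>J\<in>?P. (\<Prod>l<d. gvar (l, J l)) * gconst (c J ys)) =
        (\<Sum>J\<in>?P. if \<forall>l<d. J l = I l then gconst (c J ys) else 0)"
      unfolding iter_der_sum[OF D(1)]
      by (intro sum.cong refl, subst iter_der_monomial[where I = I]) (auto simp: D)
    also have "\<dots> = (\<Sum>J\<in>?P. if J = I then gconst (c J ys) else 0)"
      by (intro sum.cong refl) (simp add: agree)
    also have "\<dots> = gconst (c I ys)"
      using I by (simp add: finite_PiE)
    finally show ?thesis
      unfolding generic[OF ys] by (simp add: iter_der_sum[OF D(1)] iter_der_prod[OF D(1)] b_def)
  qed
  \<comment> \<open>Only the derivations \<open>D (l, I l)\<close> with \<open>f l = j\<close> act
    on factor \<open>j\<close>.\<close>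
  have "b i f j I = b i f j I'" if "\<And>l. l < d \<Longrightarrow> f l = j \<Longrightarrow> I l = I' l" for i f j I I'
    unfolding b_def using that by (intro ext iter_der_cong) auto
  from sum_of_products_regroup[of k n d b r "\<lambda>I. gconst (t I)", OF k n this]
  obtain Q :: "(nat \<times> (nat \<Rightarrow> nat) \<times> (nat \<Rightarrow> nat)) set" and v where Q: "finite Q"
    "card Q \<le> r * (k ^ d * n ^ ((k - 1) * d div k))"
    and v: "\<And>y. (\<Sum>I\<in>?P. gconst (t I) * (\<Sum>i<r. \<Sum>f\<in>?F. \<Prod>j<k. b i f j I (y j))) =
      (\<Sum>q\<in>Q. \<Prod>j<k. v q j (y j))"
    by auto
  have "gconst (\<Sum>J\<in>?P. t J * c J ys) = (\<Sum>q\<in>Q. \<Prod>j<k. v q j (ys ! j))" if "ys \<in> Y" for ys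
  proof -
    have "gconst (\<Sum>J\<in>?P. t J * c J ys) = (\<Sum>J\<in>?P. gconst (t J) * gconst (c J ys))"
      unfolding abs_gfun_const[symmetric] abs_gfun_sum abs_gfun_mult ..
    also have "\<dots> = (\<Sum>J\<in>?P. gconst (t J) * (\<Sum>i<r. \<Sum>f\<in>?F. \<Prod>j<k. b i f j J (ys ! j)))"
      by (intro sum.cong refl) (simp add: coefficient[OF that])
    finally show ?thesis using v[of "\<lambda>j. ys ! j"] by simp
  qed
  then obtain w where "\<forall>ys\<in>Y. (\<Sum>J\<in>?P. t J * c J ys) = (\<Sum>q\<in>Q. \<Prod>j<k. w q j (ys ! j))"
    using specialise_decomposition[where u = "\<lambda>ys. \<Sum>J\<in>?P. t J * c J ys" and v = v, OF Y] by blast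
  then show ?thesis by (intro exI[of _ Q] exI[of _ w] conjI Q)
qed

section \<open>Tensor rank and linear maps\<close>

lemma finite_idx: "finite (idx n d)"
proof -
  have "idx n d = {xs. set xs \<subseteq> {..<n} \<and> length xs = d}" by (auto simp: idx_def)
  then show ?thesis by (simp add: finite_lists_length_eq)
qed

lemma decomposition_imp_simples:
  assumes T: "T \<in> Ten m k" and Q: "finite Q"
    and dec: "\<And>ys. ys \<in> idx m k \<Longrightarrow> T ys = (\<Sum>q\<in>Q. \<Prod>j<k. w q j (ys ! j))"
  shows "\<exists>ts. length ts = card Q \<and> set ts \<subseteq> simples m k \<and> T = (\<lambda>xs. \<Sum>t\<leftarrow>ts. t xs)"
proof -
  obtain qs where qs: "set qs = Q" "distinct qs" using finite_distinct_list[OF Q] by blast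
  \<comment> \<open>Cutting off at \<open>m\<close> puts the factors into \<open>vecs m\<close> and
    changes nothing on \<open>idx m k\<close>.\<close>
  define vs where "vs q = map (\<lambda>j i. if i < m then w q j i else 0) [0..<k]" for q
  define ts where "ts = map (\<lambda>q. tprod m k (vs q)) qs"
  have "tprod m k (vs q) \<in> simples m k" for q
    unfolding simples_def by (rule CollectI, rule exI[of _ "vs q"]) (auto simp: vs_def vecs_def)
  then have "set ts \<subseteq> simples m k" by (auto simp: ts_def)
  moreover have "length ts = card Q"
    using distinct_card[OF qs(2)] qs(1) by (simp add: ts_def)
  moreover have "T xs = (\<Sum>t\<leftarrow>ts. t xs)" for xs
  proof -
    have "(\<Sum>t\<leftarrow>ts. t xs) = (\<Sum>q\<in>Q. tprod m k (vs q) xs)"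
      using sum_list_distinct_conv_sum_set[OF qs(2), of "\<lambda>q. tprod m k (vs q) xs"] qs(1)
      by (simp add: ts_def comp_def)
    also have "\<dots> = T xs"
    proof (cases "xs \<in> idx m k")
      case True
      then have "\<And>j. j < k \<Longrightarrow> xs ! j < m" by (auto simp: idx_def)
      then have "tprod m k (vs q) xs = (\<Prod>j<k. w q j (xs ! j))" for q
        using True by (auto simp: tprod_def vs_def intro!: prod.cong)
      then show ?thesis by (simp add: dec[OF True])
    next
      case False
      then show ?thesis using T by (simp add: Ten_def tprod_def)
    qed
    finally show ?thesis ..
  qed
  ultimately show ?thesis by (intro exI[of _ ts]) auto
qed

lemma trk_le_card:
  assumes "T \<in> Ten m k" "finite Q"
    "\<And>ys. ys \<in> idx m k \<Longrightarrow> T ys = (\<Sum>q\<in>Q. \<Prod>j<k. w q j (ys ! j))"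
  shows "trk m k T \<le> card Q"
  unfolding trk_def by (rule Least_le) (rule decomposition_imp_simples[OF assms])

text \<open>Expansion in the standard basis, with the scalar \<open>T q\<close> attached to factor
  0, which exists because \<open>k \<ge> 1\<close>.\<close>

lemma standard_decomposition:
  assumes "k \<ge> 1" "ys \<in> idx m k"
  shows "T ys = (\<Sum>q\<in>idx m k. \<Prod>j<k. if ys ! j = q ! j then (if j = 0 then T q else 1) else (0::'a::field))"
proof -
  have "(\<Prod>j<k. if ys ! j = q ! j then (if j = 0 then T q else 1) else 0) = (if q = ys then T ys else 0)"
    if q: "q \<in> idx m k" for q
  proof (cases "q = ys")
    case True
    then show ?thesis using assms(1) by (simp add: prod.delta)
  next
    case False
    then obtain j where "j < k" "ys ! j \<noteq> q ! j"
      using q assms(2) nth_equalityI[of q ys] unfolding idx_def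
      by (metis (mono_tags, lifting) mem_Collect_eq)
    then have "(\<Prod>j<k. if ys ! j = q ! j then (if j = 0 then T q else 1) else 0) = 0"
      by (intro prod_zero finite_lessThan bexI[of _ j]) simp_all
    then show ?thesis using False by simp
  qed
  then show ?thesis using assms(2) by (simp add: finite_idx)
qed

lemma trk_le_card_idx:
  assumes "k \<ge> 1" "(T :: nat list \<Rightarrow> 'a::field) \<in> Ten m k"
  shows "trk m k T \<le> card (idx m k)"
  by (rule trk_le_card[where w = "\<lambda>q j i. if i = q ! j then (if j = 0 then T q else 1) else 0"])
     (simp_all only: assms(2) finite_idx, rule standard_decomposition[OF assms(1)])

text \<open>The standard decomposition shows that the minimum defining \<open>trk\<close> is
  attained; a shortest decomposition is then padded to length \<open>r\<close>.\<close>

lemma trk_imp_decomposition: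
  fixes T :: "nat list \<Rightarrow> 'a::field"
  assumes k: "k \<ge> 1" and T: "T \<in> Ten m k" and r: "trk m k T \<le> r"
  shows "\<exists>a. \<forall>ys\<in>idx m k. T ys = (\<Sum>i<r. \<Prod>j<k. a i j (ys ! j))"
proof -
  have "\<exists>r ts. length ts = r \<and> set ts \<subseteq> simples m k \<and> T = (\<lambda>xs. \<Sum>t\<leftarrow>ts. t xs)"
    using decomposition_imp_simples[OF T finite_idx[of m k],
        of "\<lambda>q j i. if i = q ! j then (if j = 0 then T q else 1) else 0"]
      standard_decomposition[OF k] by blast
  from LeastI_ex[OF this] obtain ts where ts: "length ts = trk m k T" "set ts \<subseteq> simples m k"
    "T = (\<lambda>xs. \<Sum>t\<leftarrow>ts. t xs)"
    unfolding trk_def by blast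
  have "\<exists>vs. ts ! i = tprod m k vs" if "i < length ts" for i
    using ts(2) nth_mem[OF that] by (auto simp: simples_def)
  then obtain vs where vs: "\<And>i. i < length ts \<Longrightarrow> ts ! i = tprod m k (vs i)" by metis
  \<comment> \<open>The padding summands have zero factors, and their products vanish since
    \<open>k \<ge> 1\<close>.\<close>
  define a where "a i j = (if i < length ts then vs i ! j else (\<lambda>_. 0))" for i j
  have "T ys = (\<Sum>i<r. \<Prod>j<k. a i j (ys ! j))" if ys: "ys \<in> idx m k" for ys
  proof -
    have "T ys = (\<Sum>i<length ts. (ts ! i) ys)"
      by (simp add: ts(3) sum_list_sum_nth atLeast0LessThan)
    also have "\<dots> = (\<Sum>i<length ts. \<Prod>j<k. a i j (ys ! j))"
      using ys by (intro sum.cong) (simp_all add: vs tprod_def a_def)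
    also have "\<dots> = (\<Sum>i<r. \<Prod>j<k. a i j (ys ! j))"
    proof (rule sum.mono_neutral_left)
      show "\<forall>i\<in>{..<r} - {..<length ts}. (\<Prod>j<k. a i j (ys ! j)) = 0"
        using k by (auto simp: a_def intro!: prod_zero bexI[of _ 0])
    qed (use r ts(1) in auto)
    finally show ?thesis .
  qed
  then show ?thesis by blast
qed

section \<open>Expansion of tensors and linear maps in the standard basis\<close>

definition basis_tensor :: "nat \<Rightarrow> (nat \<Rightarrow> nat) \<Rightarrow> nat list \<Rightarrow> 'a::zero_neq_one" where
  "basis_tensor d J = (\<lambda>xs. if xs = map J [0..<d] then 1 else 0)"

lemma basis_tensor_Ten:
  assumes "J \<in> {..<d} \<rightarrow>\<^sub>E {..<n}"
  shows "basis_tensor d J \<in> Ten n d"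
  using PiE_mem[OF assms] by (auto simp: basis_tensor_def Ten_def idx_def)

lemma Ten_expand:
  fixes T :: "nat list \<Rightarrow> 'a::field"
  assumes T: "T \<in> Ten n d"
  shows "T = (\<lambda>xs. \<Sum>J\<in>{..<d} \<rightarrow>\<^sub>E {..<n}. T (map J [0..<d]) * basis_tensor d J xs)"
proof
  fix xs
  let ?P = "{..<d} \<rightarrow>\<^sub>E {..<n}"
  show "T xs = (\<Sum>J\<in>?P. T (map J [0..<d]) * basis_tensor d J xs)"
  proof (cases "xs \<in> idx n d")
    case True
    define I where "I = restrict (\<lambda>l. xs ! l) {..<d}"
    have len: "length xs = d" and mem: "\<And>l. l < d \<Longrightarrow> xs ! l < n"
      using True by (auto simp: idx_def)
    have IP: "I \<in> ?P" using mem by (simp add: I_def restrict_PiE_iff)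
    have xs: "xs = map I [0..<d]"
      by (rule nth_equalityI) (simp_all add: len I_def)
    have "xs = map J [0..<d] \<longleftrightarrow> J = I" if "J \<in> ?P" for J
    proof
      assume eq: "xs = map J [0..<d]"
      show "J = I"
      proof (rule PiE_ext[OF that IP])
        fix l assume "l \<in> {..<d}"
        then show "J l = I l" by (simp add: I_def eq)
      qed
    qed (rule xs[folded] | simp add: xs)+
    then have "(\<Sum>J\<in>?P. T (map J [0..<d]) * basis_tensor d J xs) = (\<Sum>J\<in>?P. if J = I then T xs else 0)"
      by (intro sum.cong refl) (auto simp: basis_tensor_def)
    then show ?thesis using IP by (simp add: finite_PiE)
  next
    case False
    then have "basis_tensor d J xs = (0::'a)" if "J \<in> ?P" for J
      using basis_tensor_Ten[OF that, where 'a = 'a] by (simp add: Ten_def)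
    then show ?thesis using False T by (simp add: Ten_def)
  qed
qed

lemma lin_mapD:
  assumes "lin_map n d m k \<phi>"
  shows "T \<in> Ten n d \<Longrightarrow> \<phi> T \<in> Ten m k"
    and "T \<in> Ten n d \<Longrightarrow> U \<in> Ten n d \<Longrightarrow> \<phi> (\<lambda>xs. T xs + U xs) = (\<lambda>xs. \<phi> T xs + \<phi> U xs)"
    and "T \<in> Ten n d \<Longrightarrow> \<phi> (\<lambda>xs. c * T xs) = (\<lambda>xs. c * \<phi> T xs)"
  using assms unfolding lin_map_def by blast+

lemma lin_map_sum:
  fixes \<phi> :: "(nat list \<Rightarrow> 'a::field) \<Rightarrow> nat list \<Rightarrow> 'a"
  assumes \<phi>: "lin_map n d m k \<phi>" and "finite A" "\<And>J. J \<in> A \<Longrightarrow> E J \<in> Ten n d"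
  shows "\<phi> (\<lambda>xs. \<Sum>J\<in>A. t J * E J xs) = (\<lambda>xs. \<Sum>J\<in>A. t J * \<phi> (E J) xs)"
  using assms(2,3)
proof (induction A)
  case empty
  have "(\<lambda>_. 0) \<in> Ten n d" by (simp add: Ten_def)
  from lin_mapD(3)[OF \<phi> this, of 0] show ?case by simp
next
  case (insert J A)
  have "(\<lambda>xs. t J * E J xs) \<in> Ten n d" "(\<lambda>xs. \<Sum>J\<in>A. t J * E J xs) \<in> Ten n d"
    using insert.prems by (auto simp: Ten_def intro!: sum.neutral)
  from lin_mapD(2)[OF \<phi> this] show ?case
    using insert by (simp add: lin_mapD(3)[OF \<phi>])
qed

lemma lin_map_expand:
  fixes \<phi> :: "(nat list \<Rightarrow> 'a::field) \<Rightarrow> nat list \<Rightarrow> 'a"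
  assumes \<phi>: "lin_map n d m k \<phi>" and T: "T \<in> Ten n d"
  shows "\<phi> T ys = (\<Sum>J\<in>{..<d} \<rightarrow>\<^sub>E {..<n}. T (map J [0..<d]) * \<phi> (basis_tensor d J) ys)"
proof -
  have fin: "finite ({..<d} \<rightarrow>\<^sub>E {..<n})" by (simp add: finite_PiE)
  have "\<phi> T = \<phi> (\<lambda>xs. \<Sum>J\<in>{..<d} \<rightarrow>\<^sub>E {..<n}. T (map J [0..<d]) * basis_tensor d J xs)"
    using Ten_expand[OF T] by simp
  also have "\<dots> = (\<lambda>ys. \<Sum>J\<in>{..<d} \<rightarrow>\<^sub>E {..<n}. T (map J [0..<d]) * \<phi> (basis_tensor d J) ys)"
    by (rule lin_map_sum[OF \<phi> fin basis_tensor_Ten])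
  finally show ?thesis by simp
qed

lemma simples_subset_Ten: "simples n d \<subseteq> Ten n d"
  by (auto simp: simples_def Ten_def tprod_def)

lemma trk_image_le:
  fixes \<phi> :: "(nat list \<Rightarrow> 'a::field_char_0) \<Rightarrow> nat list \<Rightarrow> 'a"
  assumes \<phi>: "lin_map n d m k \<phi>" and k: "k \<ge> 1" and n: "n \<ge> 1"
    and r: "\<And>S. S \<in> simples n d \<Longrightarrow> trk m k (\<phi> S) \<le> r"
    and T: "T \<in> Ten n d"
  shows "trk m k (\<phi> T) \<le> r * (k ^ d * n ^ ((k - 1) * d div k))"
proof -
  have "\<exists>a. \<forall>ys\<in>idx m k.
      (\<Sum>J\<in>{..<d} \<rightarrow>\<^sub>E {..<n}. (\<Prod>l<d. x (l, J l)) * \<phi> (basis_tensor d J) ys) =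
      (\<Sum>i<r. \<Prod>j<k. a i j (ys ! j))" for x :: "nat \<times> nat \<Rightarrow> 'a"
  proof -
    \<comment> \<open>A point \<open>x\<close> of the affine space is read as \<open>d\<close>
      vectors; by linearity the image of their tensor product is the multilinear expression in
      question.\<close>
    define vs where "vs = map (\<lambda>l i. if i < n then x (l, i) else 0) [0..<d]"
    define S where "S = tprod n d vs"
    have S: "S \<in> simples n d"
      unfolding simples_def S_def by (rule CollectI, rule exI[of _ vs]) (auto simp: vs_def vecs_def)
    then have ST: "S \<in> Ten n d" using simples_subset_Ten by blast
    have "S (map J [0..<d]) = (\<Prod>l<d. x (l, J l))" if "J \<in> {..<d} \<rightarrow>\<^sub>E {..<n}" for J
      using PiE_mem[OF that] by (auto simp: S_def tprod_def vs_def idx_def intro!: prod.cong)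
    then have "\<phi> S ys = (\<Sum>J\<in>{..<d} \<rightarrow>\<^sub>E {..<n}. (\<Prod>l<d. x (l, J l)) * \<phi> (basis_tensor d J) ys)" for ys
      unfolding lin_map_expand[OF \<phi> ST] by (intro sum.cong refl) simp
    then show ?thesis
      using trk_imp_decomposition[OF k lin_mapD(1)[OF \<phi> ST] r[OF S]] by simp
  qed
  from decomposition_transfer[of k n "idx m k" d "\<lambda>J. \<phi> (basis_tensor d J)" r "\<lambda>J. T (map J [0..<d])",
      OF k n finite_idx this]
  obtain Q :: "(nat \<times> (nat \<Rightarrow> nat) \<times> (nat \<Rightarrow> nat)) set" and w where Q: "finite Q"
    "card Q \<le> r * (k ^ d * n ^ ((k - 1) * d div k))"
    and w: "\<And>ys. ys \<in> idx m k \<Longrightarrow> \<phi> T ys = (\<Sum>q\<in>Q. \<Prod>j<k. w q j (ys ! j))"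
    unfolding lin_map_expand[OF \<phi> T] by auto
  have "trk m k (\<phi> T) \<le> card Q"
    by (rule trk_le_card[OF lin_mapD(1)[OF \<phi> T] Q(1) w])
  with Q(2) show ?thesis by simp
qed

theorem theorem1p7:
  fixes \<phi> :: "(nat list \<Rightarrow> 'a::field_char_0) \<Rightarrow> (nat list \<Rightarrow> 'a)"
    and n m d k :: nat
  assumes "alg_closed TYPE('a)"
    and "n \<ge> 1" and "m \<ge> 1" and "d \<ge> 1" and "k \<ge> 1"
    and "lin_map n d m k \<phi>"
    and "\<exists>T\<in>Ten n d. \<phi> T \<noteq> (\<lambda>_. 0)"
  shows "Pot n d m k \<phi> \<le> real (k ^ d * n ^ (((k - 1) * d) div k))"
proof -
  let ?N = "k ^ d * n ^ ((k - 1) * d div k)"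
  define r where "r = mu m k \<phi> (simples n d)"
  \<comment> \<open>The rank is bounded by the number of multi-indices, so each \<open>Max\<close>
    in \<open>mu\<close> ranges over a finite set.\<close>
  have fin: "finite ((\<lambda>x. trk m k (\<phi> x)) ` X)" if "X \<subseteq> Ten n d" for X
    by (rule finite_subset[of _ "{..card (idx m k)}"])
       (use that trk_le_card_idx lin_mapD(1) assms(5,6) in blast)+
  have "trk m k (\<phi> S) \<le> r" if "S \<in> simples n d" for S
    unfolding r_def mu_def by (rule Max_ge[OF fin[OF simples_subset_Ten] imageI[OF that]])
  then have "trk m k (\<phi> T) \<le> r * ?N" if "T \<in> Ten n d" for T
    using trk_image_le assms(2,5,6) that by blast
  then have "mu m k \<phi> (Ten n d) \<le> r * ?N"
    unfolding mu_def using assms(7) by (subst Max_le_iff[OF fin]) auto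
  then have "real (mu m k \<phi> (Ten n d)) \<le> real r * real ?N"
    unfolding of_nat_mult[symmetric] of_nat_le_iff .
  then show ?thesis
    \<comment> \<open>For \<open>r = 0\<close> the quotient is 0 by the convention for division by
      zero, and the bound is immediate.\<close>
    unfolding Pot_def r_def[symmetric] by (cases "r = 0") (simp_all add: divide_le_eq mult.commute)
qed

end
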